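(* Let $u\in\operatorname{dom}J$. With respect to the conditioned measures $P_n^{u,r}$, $Y_n$ satisfies the large deviation principle on $\mathcal X$, in the double limit $n\to\infty$ and $r\to0$, with rate function $$I^u(x):=\begin{cases}I(x)-J(u)&\text{if }\tilde H(x)=u,\\ \infty&\text{otherwise.}\end{cases}$$ That is, $I^u$ is a rate function, for any closed subset $F$ of $\mathcal X$ $$\lim_{r\to0}\,\limsup_{n\to\infty}\frac1{a_n}\log P_n^{u,r}\{Y_n\in F\}\le-I^u(F),$$ and for any open subset $G$ of $\mathcal X$ $$\lim_{r\to0}\,\liminf_{n\to\infty}\frac1{a_n}\log P_n^{u,r}\{Y_n\in G\}\ge-I^u(G).$$
   Context: Setting. For each $n\in\mathbb N$, $(\Omega_n,\mathcal F_n,P_n)$ is a probability space; $\sigma\ge1$ is an integer; $H_{n,1},\dots,H_{n,\sigma}:\Omega_n\to\mathbb R$ are bounded measurable functions and $H_n:=(H_{n,1},\dots,H_{n,\sigma})$; $a_n>0$ are scaling constants with $a_n\to\infty$. $\mathcal X$ is a Polish space (complete separable metric space), $Y_n:\Omega_n\to\mathcal X$ are random variables, and $\tilde H_1,\dots,\tilde H_\sigma:\mathcal X\to\mathbb R$ are bounded continuous functions such that $\lim_{n\to\infty}\sup_{\omega\in\Omega_n}|H_{n,i}(\omega)-\tilde H_i(Y_n(\omega))|=0$ for each $i$; $\tilde H:=(\tilde H_1,\dots,\tilde H_\sigma)$. A rate function on $\mathcal X$ is a function $\mathcal X\to[0,\infty]$ whose level sets $\{x: I(x)\le M\}$, $0\le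 M<\infty$, are compact. The large deviation principle (LDP) is meant in the usual sense (upper bound for closed sets, lower bound for open sets, with scaling constants $a_n$). It is assumed that with respect to $P_n$ the sequence $Y_n$ satisfies the LDP on $\mathcal X$ with scaling constants $a_n$ and some rate function $I$. For $u\in\mathbb R^\sigma$, $J(u):=\inf\{I(x):x\in\mathcal X,\ \tilde H(x)=u\}$ (with $\inf\emptyset=\infty$), and $\operatorname{dom}J:=\{u: J(u)<\infty\}$. For $r\in(0,1)$, $\{u\}^{(r)}:=[u_1-r,u_1+r]\times\cdots\times[u_\sigma-r,u_\sigma+r]$. For $u\in\operatorname{dom}J$ and $r\in(0,1)$ the microcanonical ensemble is $P_n^{u,r}\{A\}:=P_n\{A\mid H_n\in\{u\}^{(r)}\}$, $A\in\mathcal F_n$; it is well defined for all sufficiently large $n$ since $P_n\{H_n\in\{u\}^{(r)}\}>0$ for such $n$. For a rate function $K$ and $A\subset\mathcal X$, $K(A):=\inf_{x\in A}K(x)$. *)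

theory Defs
  imports "HOL-Probability.Probability"
begin

text \<open>Natural logarithm of a probability, with the convention \<open>log 0 = -\<infinity>\<close>.\<close>

definition elog :: "real \<Rightarrow> ereal" where
  "elog p = (if p \<le> 0 then -\<infinity> else ereal (ln p))"

definition rate_function :: "('x::topological_space \<Rightarrow> ereal) \<Rightarrow> bool" where
  "rate_function K \<longleftrightarrow> (\<forall>x. 0 \<le> K x) \<and> (\<forall>M::real. 0 \<le> M \<longrightarrow> compact {x. K x \<le> ereal M})"

definition log_rate ::
  "(nat \<Rightarrow> 'a measure) \<Rightarrow> (nat \<Rightarrow> 'a \<Rightarrow> 'x) \<Rightarrow> (nat \<Rightarrow> real) \<Rightarrow> 'x set \<Rightarrow> nat \<Rightarrow> ereal" where
  "log_rate Q Y a A n = ereal (1 / a n) * elog (measure (Q n) {\<omega> \<in> space (Q n). Y n \<omega> \<in> A})"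

definition LDP ::
  "(nat \<Rightarrow> 'a measure) \<Rightarrow> (nat \<Rightarrow> 'a \<Rightarrow> 'x::topological_space) \<Rightarrow> (nat \<Rightarrow> real) \<Rightarrow> ('x \<Rightarrow> ereal) \<Rightarrow> bool" where
  "LDP Q Y a K \<longleftrightarrow>
     rate_function K \<and>
     (\<forall>F. closed F \<longrightarrow> limsup (log_rate Q Y a F) \<le> - (INF x\<in>F. K x)) \<and>
     (\<forall>G. open G \<longrightarrow> liminf (log_rate Q Y a G) \<ge> - (INF x\<in>G. K x))"

text \<open>
  The principle in the double limit \<open>n \<rightarrow> \<infinity>\<close>, then \<open>r \<rightarrow> 0\<close> from above. The family of measures
  is \<open>Q r n\<close>. The limits in \<open>r\<close> are required to exist in the extended reals.
\<close>

definition LDP_double ::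
  "(real \<Rightarrow> nat \<Rightarrow> 'a measure) \<Rightarrow> (nat \<Rightarrow> 'a \<Rightarrow> 'x::topological_space) \<Rightarrow> (nat \<Rightarrow> real) \<Rightarrow>
     ('x \<Rightarrow> ereal) \<Rightarrow> bool" where
  "LDP_double Q Y a K \<longleftrightarrow>
     rate_function K \<and>
     (\<forall>F. closed F \<longrightarrow>
        (\<exists>L. ((\<lambda>r. limsup (log_rate (Q r) Y a F)) \<longlongrightarrow> L) (at_right 0) \<and> L \<le> - (INF x\<in>F. K x))) \<and>
     (\<forall>G. open G \<longrightarrow>
        (\<exists>L. ((\<lambda>r. liminf (log_rate (Q r) Y a G)) \<longlongrightarrow> L) (at_right 0) \<and> L \<ge> - (INF x\<in>G. K x)))"

definition vec_fun :: "('s::finite \<Rightarrow> 'b \<Rightarrow> real) \<Rightarrow> 'b \<Rightarrow> real ^ 's" where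
  "vec_fun h z = (\<chi> i. h i z)"

definition J_fun :: "('x \<Rightarrow> ereal) \<Rightarrow> ('s::finite \<Rightarrow> 'x \<Rightarrow> real) \<Rightarrow> real ^ 's \<Rightarrow> ereal" where
  "J_fun I Ht u = (INF x\<in>{x. vec_fun Ht x = u}. I x)"

definition eff_dom :: "('b \<Rightarrow> ereal) \<Rightarrow> 'b set" where
  "eff_dom K = {u. K u < \<infinity>}"

definition hypercube :: "real ^ 's \<Rightarrow> real \<Rightarrow> (real ^ 's) set" where
  "hypercube u r = cbox (\<chi> i. u $ i - r) (\<chi> i. u $ i + r)"

text \<open>
  The conditioned measure \<open>P\<^sub>n{\<cdot> | H\<^sub>n \<in> {u}\<^sup>(\<^sup>r\<^sup>)}\<close>; it is the null measure if the
  conditioning event has probability \<open>0\<close>.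
\<close>

definition microcanonical ::
  "(nat \<Rightarrow> 'a measure) \<Rightarrow> (nat \<Rightarrow> 's::finite \<Rightarrow> 'a \<Rightarrow> real) \<Rightarrow> real ^ 's \<Rightarrow> real \<Rightarrow> nat \<Rightarrow> 'a measure" where
  "microcanonical P H u r n =
     uniform_measure (P n) {\<omega> \<in> space (P n). vec_fun (H n) \<omega> \<in> hypercube u r}"

definition I_micro ::
  "('x \<Rightarrow> ereal) \<Rightarrow> ('s::finite \<Rightarrow> 'x \<Rightarrow> real) \<Rightarrow> real ^ 's \<Rightarrow> 'x \<Rightarrow> ereal" where
  "I_micro I Ht u x = (if vec_fun Ht x = u then I x - J_fun I Ht u else \<infinity>)"

end

theory Submission
  imports Defs
begin

text \<open>
  The conditional probability of \<open>{Y\<^sub>n \<in> A}\<close> is the quotient of the joint probability of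
  \<open>{Y\<^sub>n \<in> A, H\<^sub>n \<in> {u}\<^sup>(\<^sup>r\<^sup>)}\<close> by the same quantity with \<open>A\<close> the whole space. On the
  logarithmic scale it is a difference, so everything follows from estimates of the joint
  probabilities.

  Since \<open>H\<^sub>n\<close> is uniformly close to \<open>Ht(Y\<^sub>n)\<close>, for large \<open>n\<close> the joint event lies inside
  \<open>{Y\<^sub>n \<in> A, Ht(Y\<^sub>n) \<in> {u}\<^sup>(\<^sup>2\<^sup>r\<^sup>)}\<close> and contains the event that \<open>Y\<^sub>n \<in> A\<close> and \<open>Ht(Y\<^sub>n)\<close> lies in
  the open ball of radius \<open>r/2\<close> around \<open>u\<close>. Both are events about \<open>Y\<^sub>n\<close> alone, closed and open
  respectively when \<open>A\<close> is, so the LDP of \<open>Y\<^sub>n\<close> applies to them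
  (\<open>limsup_joint_rate_le\<close>, \<open>liminf_joint_rate_ge\<close>). The lower bound is already the wanted
  infimum of \<open>I\<close> over \<open>A \<inter> {Ht = u}\<close>. The upper bound is an infimum over a shrinking
  neighbourhood of this set, and compactness of the level sets of \<open>I\<close> makes it converge
  (\<open>rate_function_INF_hypercube_tendsto\<close>).

  For \<open>A\<close> the whole space both bounds tend to \<open>-J(u)\<close>, which is finite. So the denominator has
  exponential rate \<open>-J(u)\<close> up to an error that vanishes with \<open>r\<close>, and dividing by it adds \<open>J(u)\<close>
  to the rate of the numerator (\<open>tendsto_limsup_liminf_minus\<close>). The limits in \<open>r\<close> exist
  because the joint probabilities, unlike the conditional ones, are monotone in \<open>r\<close>.
\<close>

section \<open>Scaled logarithms and conditioning\<close>

lemma elog_mono: "p \<le> q \<Longrightarrow> elog p \<le> elog q"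
  by (auto simp: elog_def)

lemma log_rate_mono:
  assumes "a n > 0"
    and "measure (Q n) {\<omega> \<in> space (Q n). Y n \<omega> \<in> A} \<le> measure (R n) {\<omega> \<in> space (R n). Z n \<omega> \<in> B}"
  shows "log_rate Q Y a A n \<le> log_rate R Z a B n"
  unfolding log_rate_def using assms
  by (intro ereal_mult_left_mono elog_mono) auto

lemma mem_hypercube: "v \<in> hypercube u r \<longleftrightarrow> (\<forall>i. \<bar>v $ i - u $ i\<bar> \<le> r)"
  unfolding hypercube_def mem_box_cart by (auto simp: abs_le_iff algebra_simps; smt (verit))

lemma hypercube_mono: "r \<le> s \<Longrightarrow> hypercube u r \<subseteq> hypercube u s"
  unfolding subset_iff mem_hypercube by (meson order_trans)

text \<open>
  Treating \<open>(Y\<^sub>n, H\<^sub>n)\<close> as a single random element makes the joint probabilities an instance of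
  \<open>log_rate\<close>, so that its monotonicity applies to them too.
\<close>

definition joint_rate where
  "joint_rate P H Y a u A r =
     log_rate P (\<lambda>n \<omega>. (Y n \<omega>, vec_fun (H n) \<omega>)) a (A \<times> hypercube u r)"

lemma elog_divide:
  assumes "0 \<le> p" "0 < q"
  shows "elog (p / q) = elog p - elog q"
  using assms by (auto simp: elog_def ln_div divide_le_0_iff)

text \<open>
  The last hypothesis says that the conditioning event has positive probability. Then the
  subtracted term is a real number and the difference is never of the form \<open>\<infinity> - \<infinity>\<close>.
\<close>

lemma log_rate_microcanonical:
  assumes P: "prob_space (P n)" and a: "a n > 0"
    and E: "{\<omega> \<in> space (P n). vec_fun (H n) \<omega> \<in> hypercube u r} \<in> sets (P n)"
    and B: "{\<omega> \<in> space (P n). Y n \<omega> \<in> A} \<in> sets (P n)"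
    and nz: "joint_rate P H Y a u UNIV r n \<noteq> -\<infinity>"
  shows "log_rate (microcanonical P H u r) Y a A n
    = joint_rate P H Y a u A r n - joint_rate P H Y a u UNIV r n"
proof -
  interpret prob_space "P n" by fact
  let ?E = "{\<omega> \<in> space (P n). vec_fun (H n) \<omega> \<in> hypercube u r}"
  let ?B = "{\<omega> \<in> space (P n). Y n \<omega> \<in> A}"
  have pos: "measure (P n) ?E > 0"
  proof (rule ccontr)
    assume "\<not> ?thesis"
    then have "elog (measure (P n) ?E) = -\<infinity>" by (simp add: elog_def)
    with nz a show False by (simp add: joint_rate_def log_rate_def)
  qed
  have BE: "{\<omega> \<in> space (P n). Y n \<omega> \<in> A \<and> vec_fun (H n) \<omega> \<in> hypercube u r} = ?E \<inter> ?B" by auto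
  have "measure (microcanonical P H u r n) ?B = measure (P n) (?E \<inter> ?B) / measure (P n) ?E"
    unfolding microcanonical_def
    using E B pos by (subst measure_uniform_measure) (auto simp: emeasure_eq_measure)
  moreover have "space (microcanonical P H u r n) = space (P n)"
    by (simp add: microcanonical_def)
  ultimately have "log_rate (microcanonical P H u r) Y a A n
     = ereal (1 / a n) * (elog (measure (P n) (?E \<inter> ?B)) - elog (measure (P n) ?E))"
    using pos by (simp add: log_rate_def elog_divide)
  also have "\<dots> = ereal (1 / a n) * elog (measure (P n) (?E \<inter> ?B))
       - ereal (1 / a n) * elog (measure (P n) ?E)"
    using pos a by (cases "measure (P n) (?E \<inter> ?B) \<le> 0") (auto simp: elog_def algebra_simps)
  finally show ?thesis
    by (simp add: joint_rate_def log_rate_def BE)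
qed

section \<open>Limits in the extended reals\<close>

lemma mono_tendsto_at_right:
  fixes f :: "real \<Rightarrow> ereal"
  assumes "mono f"
  shows "(f \<longlongrightarrow> (INF r\<in>{x<..}. f r)) (at_right x)"
proof (rule decreasing_tendsto)
  show "\<forall>\<^sub>F r in at_right x. (INF r\<in>{x<..}. f r) \<le> f r"
    using eventually_at_right_less[of x] by eventually_elim (auto intro!: INF_lower)
next
  fix y assume "(INF r\<in>{x<..}. f r) < y"
  then obtain r where r: "r > x" "f r < y" by (auto simp: INF_less_iff)
  have "\<forall>\<^sub>F s in at_right x. s \<in> {x<..<r}"
    using r by (intro eventually_at_right_real) auto
  then show "\<forall>\<^sub>F s in at_right x. f s < y"
  proof eventually_elim
    case (elim s)
    then have "f s \<le> f r" by (intro monoD[OF assms]) auto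
    with r show ?case by auto
  qed
qed

text \<open>
  \<open>L\<close> may be infinite, as happens when the events in question have probability zero. The
  additive error is therefore quantified by real numbers, not by limits of differences.
\<close>

lemma tendsto_add_approx_ereal:
  fixes f g :: "'b \<Rightarrow> ereal" and c :: real
  assumes f: "(f \<longlongrightarrow> L) F"
    and lower: "\<And>e::real. e > 0 \<Longrightarrow> \<forall>\<^sub>F r in F. f r + ereal (c - e) \<le> g r"
    and upper: "\<And>e::real. e > 0 \<Longrightarrow> \<forall>\<^sub>F r in F. g r \<le> f r + ereal (c + e)"
  shows "(g \<longlongrightarrow> L + ereal c) F"
proof (rule order_tendstoI)
  fix y assume y: "y < L + ereal c"
  obtain z where z: "y < ereal z" "ereal z < L + ereal c"
    using ereal_dense2[OF y] by auto
  obtain w where w: "ereal z < ereal w" "ereal w < L + ereal c"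
    using ereal_dense2[OF z(2)] by auto
  have "ereal (w - c) < L" using w(2) by (cases L) auto
  then have "\<forall>\<^sub>F r in F. ereal (w - c) < f r" by (rule order_tendstoD[OF f])
  moreover have "\<forall>\<^sub>F r in F. f r + ereal (c - (w - z)) \<le> g r"
    using w(1) by (intro lower) auto
  ultimately show "\<forall>\<^sub>F r in F. y < g r"
  proof eventually_elim
    case (elim r)
    have "ereal z < f r + ereal (c - (w - z))"
      using elim(1) by (cases "f r") auto
    with z(1) elim(2) show ?case by order
  qed
next
  fix y assume y: "L + ereal c < y"
  obtain z where z: "L + ereal c < ereal z" "ereal z < y"
    using ereal_dense2[OF y] by auto
  obtain w where w: "L + ereal c < ereal w" "ereal w < ereal z"
    using ereal_dense2[OF z(1)] by auto
  have "L < ereal (w - c)" using w(1) by (cases L) auto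
  then have "\<forall>\<^sub>F r in F. f r < ereal (w - c)" by (rule order_tendstoD[OF f])
  moreover have "\<forall>\<^sub>F r in F. g r \<le> f r + ereal (c + (z - w))"
    using w(2) by (intro upper) auto
  ultimately show "\<forall>\<^sub>F r in F. y > g r"
  proof eventually_elim
    case (elim r)
    have "f r + ereal (c + (z - w)) < ereal z"
      using elim(1) by (cases "f r") auto
    with z(2) elim(2) show ?case by order
  qed
qed

lemma eventually_near_of_liminf_limsup:
  fixes D :: "real \<Rightarrow> nat \<Rightarrow> ereal"
  assumes "((\<lambda>r. limsup (D r)) \<longlongrightarrow> - ereal j) F"
    and "\<forall>\<^sub>F r in F. - ereal j \<le> liminf (D r)" and "e > 0"
  shows "\<forall>\<^sub>F r in F. \<forall>\<^sub>F n in sequentially.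
     ereal (- j - e) < D r n \<and> D r n < ereal (- j + e)"
proof -
  have "\<forall>\<^sub>F r in F. limsup (D r) < ereal (- j + e)"
    using assms(3) by (intro order_tendstoD(2)[OF assms(1)]) simp
  with assms(2) show ?thesis
  proof eventually_elim
    case (elim r)
    have "ereal (- j - e) < - ereal j" using assms(3) by simp
    then have "ereal (- j - e) < liminf (D r)" using elim(1) by order
    then show ?case
      using elim(2) by (auto intro!: eventually_conj simp: less_LiminfD Limsup_lessD)
  qed
qed

lemma Limsup_add_real:
  fixes X :: "nat \<Rightarrow> ereal" and c :: real
  shows "limsup (\<lambda>n. X n + ereal c) = limsup X + ereal c"
  by (rule Limsup_add_ereal_right) auto

lemma Liminf_add_real:
  fixes X :: "nat \<Rightarrow> ereal" and c :: real
  shows "liminf (\<lambda>n. X n + ereal c) = liminf X + ereal c"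
  by (rule Liminf_add_ereal_right) auto

text \<open>
  Dividing by a sequence of known exponential rate: \<open>N\<close>, \<open>D\<close> and \<open>Q\<close> stand for the scaled
  logarithms of numerator, denominator and quotient. Once \<open>D r n\<close> is trapped in a small
  interval around \<open>-j\<close>, the sequences \<open>Q r\<close> and \<open>N r + j\<close> differ by a small real number, and
  this survives both the limit superior and the limit inferior in \<open>n\<close>.
\<close>

lemma tendsto_limsup_liminf_minus:
  fixes N D Q :: "real \<Rightarrow> nat \<Rightarrow> ereal"
  assumes D: "((\<lambda>r. limsup (D r)) \<longlongrightarrow> - ereal j) F"
      "\<forall>\<^sub>F r in F. - ereal j \<le> liminf (D r)"
    and Q: "\<And>r n. D r n \<noteq> -\<infinity> \<Longrightarrow> Q r n = N r n - D r n"
  shows "((\<lambda>r. limsup (N r)) \<longlongrightarrow> L) F \<Longrightarrow> ((\<lambda>r. limsup (Q r)) \<longlongrightarrow> L + ereal j) F"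
    and "((\<lambda>r. liminf (N r)) \<longlongrightarrow> L) F \<Longrightarrow> ((\<lambda>r. liminf (Q r)) \<longlongrightarrow> L + ereal j) F"
proof -
  have near: "\<forall>\<^sub>F r in F. \<forall>\<^sub>F n in sequentially.
     N r n + ereal (j - e) \<le> Q r n \<and> Q r n \<le> N r n + ereal (j + e)" if "e > 0" for e
    using eventually_near_of_liminf_limsup[OF D that]
  proof eventually_elim
    case (elim r)
    then show ?case
    proof eventually_elim
      case (elim n)
      then obtain d where d: "D r n = ereal d" by (cases "D r n") auto
      then show ?case using elim Q[of r n] by (cases "N r n") auto
    qed
  qed
  show "((\<lambda>r. limsup (Q r)) \<longlongrightarrow> L + ereal j) F" if "((\<lambda>r. limsup (N r)) \<longlongrightarrow> L) F"
  proof (rule tendsto_add_approx_ereal[OF that])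
    fix e :: real assume "e > 0"
    note near[OF this]
    then show "\<forall>\<^sub>F r in F. limsup (N r) + ereal (j - e) \<le> limsup (Q r)"
      by eventually_elim (auto simp: Limsup_add_real[symmetric] elim!: eventually_mono intro!: Limsup_mono)
    show "\<forall>\<^sub>F r in F. limsup (Q r) \<le> limsup (N r) + ereal (j + e)"
      using near[OF \<open>e > 0\<close>]
      by eventually_elim (auto simp: Limsup_add_real[symmetric] elim!: eventually_mono intro!: Limsup_mono)
  qed
  show "((\<lambda>r. liminf (Q r)) \<longlongrightarrow> L + ereal j) F" if "((\<lambda>r. liminf (N r)) \<longlongrightarrow> L) F"
  proof (rule tendsto_add_approx_ereal[OF that])
    fix e :: real assume "e > 0"
    note near[OF this]
    then show "\<forall>\<^sub>F r in F. liminf (N r) + ereal (j - e) \<le> liminf (Q r)"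
      by eventually_elim (auto simp: Liminf_add_real[symmetric] elim!: eventually_mono intro!: Liminf_mono)
    show "\<forall>\<^sub>F r in F. liminf (Q r) \<le> liminf (N r) + ereal (j + e)"
      using near[OF \<open>e > 0\<close>]
      by eventually_elim (auto simp: Liminf_add_real[symmetric] elim!: eventually_mono intro!: Liminf_mono)
  qed
qed

section \<open>Rate functions\<close>

text \<open>
  If the infima stayed below some \<open>c\<close> smaller than the infimum over \<open>F \<inter> {f = u}\<close>, there would be
  points of \<open>F\<close> in the compact level set \<open>{K \<le> c}\<close> whose values under \<open>f\<close> tend to \<open>u\<close>. A cluster
  point of these lies in \<open>F \<inter> {f = u}\<close> and still satisfies \<open>K \<le> c\<close>, a contradiction.
\<close>

lemma rate_function_INF_hypercube_tendsto:
  fixes K :: "'x::metric_space \<Rightarrow> ereal" and f :: "'x \<Rightarrow> real ^ 's"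
  assumes K: "rate_function K" and F: "closed F" and f: "continuous_on UNIV f"
  shows "((\<lambda>r. INF x\<in>F \<inter> f -` hypercube u r. K x) \<longlongrightarrow> (INF x\<in>F \<inter> f -` {u}. K x)) (at_right 0)"
proof (rule increasing_tendsto)
  have "(INF x\<in>F \<inter> f -` hypercube u r. K x) \<le> (INF x\<in>F \<inter> f -` {u}. K x)" if "r > 0" for r
    using that by (intro INF_superset_mono) (auto simp: mem_hypercube)
  then show "\<forall>\<^sub>F r in at_right 0. (INF x\<in>F \<inter> f -` hypercube u r. K x) \<le> (INF x\<in>F \<inter> f -` {u}. K x)"
    by (simp add: eventually_at_filter)
next
  fix y assume y: "y < (INF x\<in>F \<inter> f -` {u}. K x)"
  obtain c where c: "y < ereal c" "ereal c < (INF x\<in>F \<inter> f -` {u}. K x)"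
    using ereal_dense2[OF y] by auto
  have cpt: "compact {x. K x \<le> ereal c}"
  proof (cases "c \<ge> 0")
    case True then show ?thesis using K by (simp add: rate_function_def)
  next
    case False
    \<comment> \<open>The definition of a rate function speaks of levels \<open>M \<ge> 0\<close> only; below, they are empty.\<close>
    then have "\<not> K x \<le> ereal c" for x
      using K unfolding rate_function_def by (metis ereal_less_eq(5) order_trans)
    then show ?thesis by simp
  qed
  have "\<exists>\<rho>>0. \<forall>x\<in>F \<inter> f -` hypercube u \<rho>. ereal c < K x"
  proof (rule ccontr)
    assume "\<not> ?thesis"
    then have "\<exists>x. x \<in> F \<and> f x \<in> hypercube u (inverse (Suc k)) \<and> K x \<le> ereal c" for k
      by (force simp: not_less)
    then obtain X where X: "\<And>k. X k \<in> F" "\<And>k. f (X k) \<in> hypercube u (inverse (Suc k))"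
        "\<And>k. K (X k) \<le> ereal c" by metis
    obtain l s where l: "K l \<le> ereal c" and s: "strict_mono (s :: nat \<Rightarrow> nat)" "(X \<circ> s) \<longlonglongrightarrow> l"
      using cpt[unfolded compact_eq_seq_compact_metric seq_compact_def] X(3) by (force simp: Ball_def)
    have lF: "l \<in> F"
      using closed_sequentially[OF F _ s(2)] X(1) by auto
    have fl: "(\<lambda>k. f (X (s k))) \<longlonglongrightarrow> f l"
      using continuous_on_tendsto_compose[OF f s(2)] by (simp add: o_def)
    have "f l $ i = u $ i" for i
    proof -
      have "(\<lambda>k. \<bar>f (X (s k)) $ i - u $ i\<bar>) \<longlonglongrightarrow> \<bar>f l $ i - u $ i\<bar>"
        by (intro tendsto_intros fl)
      moreover have "(\<lambda>k. inverse (real (Suc (s k)))) \<longlonglongrightarrow> 0"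
        using LIMSEQ_subseq_LIMSEQ[OF LIMSEQ_inverse_real_of_nat s(1)] by (simp add: o_def)
      ultimately have "\<bar>f l $ i - u $ i\<bar> \<le> 0"
        using X(2) by (intro LIMSEQ_le) (auto simp: mem_hypercube)
      then show ?thesis by simp
    qed
    then have "l \<in> F \<inter> f -` {u}" using lF by (auto simp: vec_eq_iff)
    then have "(INF x\<in>F \<inter> f -` {u}. K x) \<le> K l" by (rule INF_lower)
    with c(2) l show False by order
  qed
  then obtain \<rho> where \<rho>: "\<rho> > 0" "\<And>x. x \<in> F \<inter> f -` hypercube u \<rho> \<Longrightarrow> ereal c < K x" by blast
  have "\<forall>\<^sub>F r in at_right 0. r \<in> {0<..<\<rho>}"
    using \<rho> by (intro eventually_at_right_real) auto
  then show "\<forall>\<^sub>F r in at_right 0. y < (INF x\<in>F \<inter> f -` hypercube u r. K x)"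
  proof eventually_elim
    case (elim r)
    then have "hypercube u r \<subseteq> hypercube u \<rho>" by (intro hypercube_mono) auto
    then have "ereal c \<le> (INF x\<in>F \<inter> f -` hypercube u r. K x)"
      using \<rho>(2) by (intro INF_greatest less_imp_le) auto
    with c(1) show ?case by order
  qed
qed

lemma J_fun_real:
  assumes "rate_function I" and "u \<in> eff_dom (J_fun I Ht)"
  obtains j where "J_fun I Ht u = ereal j" "j \<ge> 0"
proof -
  have "J_fun I Ht u \<ge> 0"
    using assms(1) unfolding J_fun_def rate_function_def by (auto intro: INF_greatest)
  moreover have "J_fun I Ht u < \<infinity>" using assms(2) by (simp add: eff_dom_def)
  ultimately show ?thesis using that by (cases "J_fun I Ht u") auto
qed

lemma rate_function_I_micro:
  fixes I :: "'x::t2_space \<Rightarrow> ereal"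
  assumes I: "rate_function I" and u: "u \<in> eff_dom (J_fun I Ht)"
    and Ht: "continuous_on UNIV (vec_fun Ht)"
  shows "rate_function (I_micro I Ht u)"
proof -
  obtain j where j: "J_fun I Ht u = ereal j" "j \<ge> 0" using J_fun_real[OF I u] .
  have "0 \<le> I_micro I Ht u x" for x
  proof (cases "vec_fun Ht x = u")
    case True
    then have "ereal j \<le> I x" unfolding j(1)[symmetric] J_fun_def by (intro INF_lower) auto
    then show ?thesis using True by (cases "I x") (auto simp: I_micro_def j)
  qed (simp add: I_micro_def)
  moreover have "compact {x. I_micro I Ht u x \<le> ereal M}" if "M \<ge> 0" for M
  proof -
    have "{x. I_micro I Ht u x \<le> ereal M} = {x. I x \<le> ereal (M + j)} \<inter> vec_fun Ht -` {u}"
    proof -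
      have "I x - ereal j \<le> ereal M \<longleftrightarrow> I x \<le> ereal (M + j)" for x
        by (cases "I x") auto
      then show ?thesis by (auto simp: I_micro_def j)
    qed
    moreover have "closed (vec_fun Ht -` {u})"
      using Ht by (intro closed_vimage) auto
    ultimately show ?thesis
      using I that j by (auto simp: rate_function_def intro!: compact_Int_closed)
  qed
  ultimately show ?thesis by (simp add: rate_function_def)
qed

text \<open>
  Outside \<open>{Ht = u}\<close> the conditioned rate function is \<open>\<infinity>\<close> and does not affect the infimum.
  Subtracting the finite constant \<open>j\<close> commutes with the infimum even if \<open>A\<close> misses
  \<open>{Ht = u}\<close>, as both sides are then \<open>\<infinity>\<close>.
\<close>

lemma INF_I_micro:
  assumes j: "J_fun I Ht u = ereal j"
  shows "(INF x\<in>A. I_micro I Ht u x) = (INF x\<in>A \<inter> vec_fun Ht -` {u}. I x) - ereal j"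
proof (rule antisym)
  have "(INF x\<in>A. I_micro I Ht u x) + ereal j \<le> (INF x\<in>A \<inter> vec_fun Ht -` {u}. I x)"
  proof (rule INF_greatest)
    fix x assume x: "x \<in> A \<inter> vec_fun Ht -` {u}"
    then have "(INF x\<in>A. I_micro I Ht u x) \<le> I x - ereal j"
      using INF_lower[of x A "I_micro I Ht u"] by (simp add: I_micro_def j)
    then show "(INF x\<in>A. I_micro I Ht u x) + ereal j \<le> I x"
      by (simp add: ereal_le_minus_iff)
  qed
  then show "(INF x\<in>A. I_micro I Ht u x) \<le> (INF x\<in>A \<inter> vec_fun Ht -` {u}. I x) - ereal j"
    by (simp add: ereal_le_minus_iff)
next
  show "(INF x\<in>A \<inter> vec_fun Ht -` {u}. I x) - ereal j \<le> (INF x\<in>A. I_micro I Ht u x)"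
  proof (rule INF_greatest)
    fix x assume "x \<in> A"
    then show "(INF x\<in>A \<inter> vec_fun Ht -` {u}. I x) - ereal j \<le> I_micro I Ht u x"
      by (auto simp: I_micro_def j intro!: ereal_minus_mono INF_lower)
  qed
qed

section \<open>Large deviations of the joint events\<close>

locale ldp_with_representation =
  fixes P :: "nat \<Rightarrow> 'a measure"
    and H :: "nat \<Rightarrow> 's::finite \<Rightarrow> 'a \<Rightarrow> real"
    and a :: "nat \<Rightarrow> real"
    and Y :: "nat \<Rightarrow> 'a \<Rightarrow> 'x::polish_space"
    and Ht :: "'s \<Rightarrow> 'x \<Rightarrow> real"
    and I :: "'x \<Rightarrow> ereal"
  assumes prob: "\<And>n. prob_space (P n)"
    and H_meas: "\<And>n i. H n i \<in> borel_measurable (P n)"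
    and H_bounded: "\<And>n i. bounded (H n i ` space (P n))"
    and a_pos: "\<And>n. a n > 0"
    and Y_meas: "\<And>n. Y n \<in> measurable (P n) borel"
    and Ht_cont: "\<And>i. continuous_on UNIV (Ht i)"
    and Ht_bounded: "\<And>i. bounded (range (Ht i))"
    and H_Ht: "\<And>i. (\<lambda>n. SUP \<omega>\<in>space (P n). \<bar>H n i \<omega> - Ht i (Y n \<omega>)\<bar>) \<longlonglongrightarrow> 0"
    and LDP: "LDP P Y a I"
begin

lemma rate_I: "rate_function I"
  using LDP by (simp add: LDP_def)

lemma continuous_vec_Ht: "continuous_on UNIV (vec_fun Ht)"
  unfolding vec_fun_def by (intro continuous_on_vec_lambda Ht_cont)

lemma measurable_vec_H: "vec_fun (H n) \<in> borel_measurable (P n)"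
proof (rule borel_measurable_euclidean_space[THEN iffD2], intro ballI)
  fix b :: "real ^ 's" assume "b \<in> Basis"
  then obtain i where "b = axis i 1" by (auto simp: Basis_vec_def)
  then show "(\<lambda>x. vec_fun (H n) x \<bullet> b) \<in> borel_measurable (P n)"
    using H_meas by (simp add: vec_fun_def inner_axis)
qed

lemma energy_event_sets: "{\<omega> \<in> space (P n). vec_fun (H n) \<omega> \<in> hypercube u r} \<in> sets (P n)"
  using measurable_sets[OF measurable_vec_H, of "hypercube u r"]
  by (simp add: vimage_def Int_def hypercube_def conj_commute)

lemma Y_event_sets: "A \<in> sets borel \<Longrightarrow> {\<omega> \<in> space (P n). Y n \<omega> \<in> A} \<in> sets (P n)"
  using measurable_sets[OF Y_meas, of A n]
  by (simp add: vimage_def Int_def conj_commute)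

lemma joint_event_sets:
  assumes "A \<in> sets borel"
  shows "{\<omega> \<in> space (P n). (Y n \<omega>, vec_fun (H n) \<omega>) \<in> A \<times> hypercube u r} \<in> sets (P n)"
proof -
  have "{\<omega> \<in> space (P n). (Y n \<omega>, vec_fun (H n) \<omega>) \<in> A \<times> hypercube u r} =
      {\<omega> \<in> space (P n). Y n \<omega> \<in> A} \<inter> {\<omega> \<in> space (P n). vec_fun (H n) \<omega> \<in> hypercube u r}"
    by auto
  then show ?thesis using energy_event_sets Y_event_sets[OF assms] by simp
qed

lemma eventually_H_near_Ht:
  assumes "\<delta> > 0"
  shows "\<forall>\<^sub>F n in sequentially. \<forall>\<omega>\<in>space (P n). \<forall>i. \<bar>H n i \<omega> - Ht i (Y n \<omega>)\<bar> < \<delta>"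
proof -
  have "\<forall>\<^sub>F n in sequentially. \<forall>i. (SUP \<omega>\<in>space (P n). \<bar>H n i \<omega> - Ht i (Y n \<omega>)\<bar>) < \<delta>"
    using order_tendstoD(2)[OF H_Ht assms] by (simp add: eventually_all_finite)
  then show ?thesis
  proof (eventually_elim, intro ballI allI)
    fix n \<omega> i
    assume less: "\<forall>i. (SUP \<omega>\<in>space (P n). \<bar>H n i \<omega> - Ht i (Y n \<omega>)\<bar>) < \<delta>" and \<omega>: "\<omega> \<in> space (P n)"
    obtain B C where B: "\<And>\<omega>. \<omega> \<in> space (P n) \<Longrightarrow> \<bar>H n i \<omega>\<bar> \<le> B" and C: "\<And>x. \<bar>Ht i x\<bar> \<le> C"
      using H_bounded[of n i] Ht_bounded[of i] by (auto simp: bounded_iff)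
    have "\<bar>H n i \<omega> - Ht i (Y n \<omega>)\<bar> \<le> B + C" if "\<omega> \<in> space (P n)" for \<omega>
      using B[OF that] C[of "Y n \<omega>"] by linarith
    then have "bdd_above ((\<lambda>\<omega>. \<bar>H n i \<omega> - Ht i (Y n \<omega>)\<bar>) ` space (P n))"
      by (rule bdd_aboveI2)
    then have "\<bar>H n i \<omega> - Ht i (Y n \<omega>)\<bar> \<le> (SUP \<omega>\<in>space (P n). \<bar>H n i \<omega> - Ht i (Y n \<omega>)\<bar>)"
      using \<omega> by (intro cSUP_upper)
    with less show "\<bar>H n i \<omega> - Ht i (Y n \<omega>)\<bar> < \<delta>" by (meson le_less_trans)
  qed
qed

lemma joint_rate_mono:
  assumes "A \<in> sets borel" "r \<le> s"
  shows "joint_rate P H Y a u A r n \<le> joint_rate P H Y a u A s n"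
proof -
  interpret prob_space "P n" by (rule prob)
  show ?thesis
    unfolding joint_rate_def
    using hypercube_mono[OF assms(2), of u] joint_event_sets[OF assms(1), of n u s]
    by (intro log_rate_mono a_pos finite_measure_mono) auto
qed

text \<open>
  Passing from \<open>H\<^sub>n\<close> to \<open>Ht(Y\<^sub>n)\<close> costs an arbitrarily small enlargement of the cube. The
  factor \<open>2\<close> is harmless because the enlarged cubes still shrink to \<open>u\<close> as \<open>r\<close> tends to \<open>0\<close>.
\<close>

lemma limsup_joint_rate_le:
  assumes "closed F" "r > 0"
  shows "limsup (joint_rate P H Y a u F r) \<le> - (INF x\<in>F \<inter> vec_fun Ht -` hypercube u (2 * r). I x)"
proof -
  let ?F = "F \<inter> vec_fun Ht -` hypercube u (2 * r)"
  have F: "closed ?F"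
    unfolding hypercube_def
    by (intro closed_Int assms closed_vimage closed_cbox continuous_vec_Ht)
  have "\<forall>\<^sub>F n in sequentially. joint_rate P H Y a u F r n \<le> log_rate P Y a ?F n"
    using eventually_H_near_Ht[OF assms(2)]
  proof eventually_elim
    case (elim n)
    interpret prob_space "P n" by (rule prob)
    have "vec_fun Ht (Y n \<omega>) \<in> hypercube u (2 * r)"
      if "\<omega> \<in> space (P n)" "vec_fun (H n) \<omega> \<in> hypercube u r" for \<omega>
      unfolding mem_hypercube
    proof
      fix i
      have "\<bar>H n i \<omega> - Ht i (Y n \<omega>)\<bar> < r" "\<bar>H n i \<omega> - u $ i\<bar> \<le> r"
        using elim that by (auto simp: mem_hypercube vec_fun_def)
      then show "\<bar>vec_fun Ht (Y n \<omega>) $ i - u $ i\<bar> \<le> 2 * r" by (simp add: vec_fun_def)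
    qed
    then show ?case
      unfolding joint_rate_def
      using Y_event_sets[of ?F n] F
      by (intro log_rate_mono a_pos finite_measure_mono) auto
  qed
  then have "limsup (joint_rate P H Y a u F r) \<le> limsup (log_rate P Y a ?F)"
    by (rule Limsup_mono)
  also have "\<dots> \<le> - (INF x\<in>?F. I x)" using LDP F by (simp add: LDP_def)
  finally show ?thesis .
qed

text \<open>
  The LDP is applied to the open event that \<open>Ht(Y\<^sub>n)\<close> falls in a ball around \<open>u\<close> well inside
  the cube. Enlarging \<open>{Ht = u}\<close> to the preimage of this ball can only lower the infimum of \<open>I\<close>,
  which is the favourable direction here; so the bound holds at each \<open>r\<close>, without a limit.
\<close>

lemma liminf_joint_rate_ge:
  assumes "open G" "r > 0"
  shows "- (INF x\<in>G \<inter> vec_fun Ht -` {u}. I x) \<le> liminf (joint_rate P H Y a u G r)"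
proof -
  let ?G = "G \<inter> vec_fun Ht -` ball u (r / 2)"
  have G: "open ?G"
    by (intro open_Int assms open_vimage open_ball continuous_vec_Ht)
  have "(INF x\<in>?G. I x) \<le> (INF x\<in>G \<inter> vec_fun Ht -` {u}. I x)"
    using assms(2) by (intro INF_superset_mono) auto
  then have "- (INF x\<in>G \<inter> vec_fun Ht -` {u}. I x) \<le> - (INF x\<in>?G. I x)"
    by simp
  also have "\<dots> \<le> liminf (log_rate P Y a ?G)" using LDP G by (simp add: LDP_def)
  also have "\<dots> \<le> liminf (joint_rate P H Y a u G r)"
  proof (rule Liminf_mono)
    have "r / 2 > 0" using assms by simp
    from eventually_H_near_Ht[OF this]
    show "\<forall>\<^sub>F n in sequentially. log_rate P Y a ?G n \<le> joint_rate P H Y a u G r n"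
    proof eventually_elim
      case (elim n)
      interpret prob_space "P n" by (rule prob)
      have "vec_fun (H n) \<omega> \<in> hypercube u r"
        if "\<omega> \<in> space (P n)" "vec_fun Ht (Y n \<omega>) \<in> ball u (r / 2)" for \<omega>
        unfolding mem_hypercube
      proof
        fix i
        have "\<bar>H n i \<omega> - Ht i (Y n \<omega>)\<bar> < r / 2" using elim that by blast
        moreover have "\<bar>Ht i (Y n \<omega>) - u $ i\<bar> < r / 2"
          using component_le_norm_cart[of "vec_fun Ht (Y n \<omega>) - u" i] that
          by (simp add: vec_fun_def dist_norm norm_minus_commute)
        ultimately show "\<bar>vec_fun (H n) \<omega> $ i - u $ i\<bar> \<le> r" unfolding vec_fun_def vec_lambda_beta by linarith
      qed
      then show ?case
        unfolding joint_rate_def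
        using joint_event_sets[of G n u r] assms(1)
        by (intro log_rate_mono a_pos finite_measure_mono) auto
    qed
  qed
  finally show ?thesis .
qed

lemma tendsto_upper_joint_bound:
  assumes "closed F"
  shows "((\<lambda>r. - (INF x\<in>F \<inter> vec_fun Ht -` hypercube u (2 * r). I x))
     \<longlongrightarrow> - (INF x\<in>F \<inter> vec_fun Ht -` {u}. I x)) (at_right 0)"
proof -
  have "filterlim (\<lambda>r::real. 2 * r) (at_right 0) (at_right 0)"
    by (rule filterlim_times_pos[where c = 2, simplified, OF filterlim_ident]) auto
  from filterlim_compose[OF rate_function_INF_hypercube_tendsto[OF rate_I assms continuous_vec_Ht] this]
  show ?thesis by (intro tendsto_uminus_ereal)
qed

theorem LDP_double_microcanonical:
  assumes u: "u \<in> eff_dom (J_fun I Ht)"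
  shows "LDP_double (microcanonical P H u) Y a (I_micro I Ht u)"
proof -
  let ?N = "joint_rate P H Y a u"
  obtain j where j: "J_fun I Ht u = ereal j" "j \<ge> 0" using J_fun_real[OF rate_I u] .
  have pos: "\<forall>\<^sub>F r in at_right 0. (0::real) < r" by (rule eventually_at_right_less)
  have j_UNIV: "(INF x\<in>UNIV \<inter> vec_fun Ht -` {u}. I x) = ereal j"
    using j(1) by (simp add: J_fun_def vimage_def)
  have D_liminf: "\<forall>\<^sub>F r in at_right 0. - ereal j \<le> liminf (?N UNIV r)"
    using pos by eventually_elim (use liminf_joint_rate_ge[of UNIV _ u] j_UNIV in auto)
  have D_limsup: "((\<lambda>r. limsup (?N UNIV r)) \<longlongrightarrow> - ereal j) (at_right 0)"
  proof (rule tendsto_sandwich[OF _ _ tendsto_const])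
    show "((\<lambda>r. - (INF x\<in>UNIV \<inter> vec_fun Ht -` hypercube u (2 * r). I x)) \<longlongrightarrow> - ereal j) (at_right 0)"
      using tendsto_upper_joint_bound[of UNIV u] j_UNIV by simp
    show "\<forall>\<^sub>F r in at_right 0. - ereal j \<le> limsup (?N UNIV r)"
      using D_liminf
    proof eventually_elim
      case (elim r)
      have "liminf (?N UNIV r) \<le> limsup (?N UNIV r)" by (rule Liminf_le_Limsup) simp
      with elim show ?case by order
    qed
    show "\<forall>\<^sub>F r in at_right 0. limsup (?N UNIV r)
        \<le> - (INF x\<in>UNIV \<inter> vec_fun Ht -` hypercube u (2 * r). I x)"
      using pos by eventually_elim (rule limsup_joint_rate_le; simp)
  qed
  have quot: "log_rate (microcanonical P H u r) Y a A n = ?N A r n - ?N UNIV r n"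
    if "?N UNIV r n \<noteq> -\<infinity>" "A \<in> sets borel" for A r n
    using that by (intro log_rate_microcanonical prob a_pos energy_event_sets Y_event_sets)
  show ?thesis
    unfolding LDP_double_def
  proof (intro conjI allI impI)
    show "rate_function (I_micro I Ht u)"
      by (rule rate_function_I_micro[OF rate_I u continuous_vec_Ht])
  next
    fix F :: "'x set" assume F: "closed F"
    then have Fb: "F \<in> sets borel" by simp
    define L where "L = (INF r\<in>{0<..}. limsup (?N F r))"
    have L: "((\<lambda>r. limsup (?N F r)) \<longlongrightarrow> L) (at_right 0)"
      unfolding L_def using joint_rate_mono[OF Fb]
      by (intro mono_tendsto_at_right monoI Limsup_mono always_eventually) auto
    have "L \<le> - (INF x\<in>F \<inter> vec_fun Ht -` {u}. I x)"
      by (rule tendsto_le[OF _ tendsto_upper_joint_bound[OF F] L])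
         (use pos limsup_joint_rate_le[OF F] in \<open>auto elim: eventually_mono\<close>)
    then have "L + ereal j \<le> - (INF x\<in>F. I_micro I Ht u x)"
      unfolding INF_I_micro[OF j(1)]
      by (cases L; cases "INF x\<in>F \<inter> vec_fun Ht -` {u}. I x") auto
    moreover have "((\<lambda>r. limsup (log_rate (microcanonical P H u r) Y a F)) \<longlongrightarrow> L + ereal j) (at_right 0)"
      by (rule tendsto_limsup_liminf_minus(1)[OF D_limsup D_liminf quot L]) (use Fb in auto)
    ultimately show "\<exists>L. ((\<lambda>r. limsup (log_rate (microcanonical P H u r) Y a F)) \<longlongrightarrow> L) (at_right 0)
        \<and> L \<le> - (INF x\<in>F. I_micro I Ht u x)" by blast
  next
    fix G :: "'x set" assume G: "open G"
    then have Gb: "G \<in> sets borel" by simp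
    define L where "L = (INF r\<in>{0<..}. liminf (?N G r))"
    have L: "((\<lambda>r. liminf (?N G r)) \<longlongrightarrow> L) (at_right 0)"
      unfolding L_def using joint_rate_mono[OF Gb]
      by (intro mono_tendsto_at_right monoI Liminf_mono always_eventually) auto
    have "- (INF x\<in>G \<inter> vec_fun Ht -` {u}. I x) \<le> L"
      unfolding L_def using liminf_joint_rate_ge[OF G] by (intro INF_greatest) auto
    then have "- (INF x\<in>G. I_micro I Ht u x) \<le> L + ereal j"
      unfolding INF_I_micro[OF j(1)]
      by (cases L; cases "INF x\<in>G \<inter> vec_fun Ht -` {u}. I x") auto
    moreover have "((\<lambda>r. liminf (log_rate (microcanonical P H u r) Y a G)) \<longlongrightarrow> L + ereal j) (at_right 0)"
      by (rule tendsto_limsup_liminf_minus(2)[OF D_limsup D_liminf quot L]) (use Gb in auto)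
    ultimately show "\<exists>L. ((\<lambda>r. liminf (log_rate (microcanonical P H u r) Y a G)) \<longlongrightarrow> L) (at_right 0)
        \<and> L \<ge> - (INF x\<in>G. I_micro I Ht u x)" by blast
  qed
qed

end

theorem theorem3p2:
  fixes P :: "nat \<Rightarrow> 'a measure"
    and H :: "nat \<Rightarrow> 's::finite \<Rightarrow> 'a \<Rightarrow> real"
    and a :: "nat \<Rightarrow> real"
    and Y :: "nat \<Rightarrow> 'a \<Rightarrow> 'x::polish_space"
    and Ht :: "'s \<Rightarrow> 'x \<Rightarrow> real"
    and I :: "'x \<Rightarrow> ereal"
    and u :: "real ^ 's"
  assumes "\<And>n. prob_space (P n)"
    and "\<And>n i. H n i \<in> borel_measurable (P n)"
    and "\<And>n i. bounded (H n i ` space (P n))"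
    and "\<And>n. a n > 0"
    and "filterlim a at_top sequentially"
    and "\<And>n. Y n \<in> measurable (P n) borel"
    and "\<And>i. continuous_on UNIV (Ht i)"
    and "\<And>i. bounded (range (Ht i))"
    and "\<And>i. (\<lambda>n. SUP \<omega>\<in>space (P n). \<bar>H n i \<omega> - Ht i (Y n \<omega>)\<bar>) \<longlonglongrightarrow> 0"
    and "LDP P Y a I"
    and "u \<in> eff_dom (J_fun I Ht)"
  shows "LDP_double (microcanonical P H u) Y a (I_micro I Ht u)"
proof -
  interpret ldp_with_representation P H a Y Ht I
    using assms(1-4,6-10) by (intro ldp_with_representation.intro)
  show ?thesis by (rule LDP_double_microcanonical) fact
qed

end
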